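(* Let $X$ be a topological space. If ${\sf NW}(\Omega_X,\Omega_X)$ holds, then for all positive integers $n$ and $k$, $\Omega_X\rightarrow(\Omega_X)^n_k$.
   Context: An $\omega$-cover of $X$ is an open cover $\mathcal{U}$ with $X\notin\mathcal{U}$ such that each finite subset of $X$ lies in some member of $\mathcal{U}$; $\Omega_X$ is the set of $\omega$-covers. $[S]^{\aleph_0}$, $[S]^{<\aleph_0}$, $[S]^n$ denote the countably infinite, the finite, and the $n$-element subsets of $S$. For a countably infinite $A$ fix a bijective enumeration $A=\{a_n:n\in\mathbb{N}\}$; for $s,T\subseteq A$, $s<T$ means $a_n\in s$, $a_m\in T$ imply $n<m$; a finite $s\subseteq C$ is an initial segment of $C\subseteq A$ if $s<C\setminus s$. A family $\mathcal{T}\subseteq[A]^{<\aleph_0}$ is thin if no element of $\mathcal{T}$ is an initial segment of another element of $\mathcal{T}$. ${\sf NW}(\Omega_X,\Omega_X)$: for every countably infinite $A\in\Omega_X$, every thin $\mathcal{T}\subseteq[A]^{<\aleph_0}$, every positive integer $n$ and every partition $\mathcal{T}=\mathcal{T}_1\cup\cdots\cup\mathcal{T}_n$ there are $B\in[A]^{\aleph_0}\cap\Omega_X$ and $i$ with $[B]^{<\aleph_0}\cap\mathcal{T}\subseteq\mathcal{T}_i$. $\Omega_X\rightarrow(\Omega_X)^n_k$: for every countable $A\in\Omega_X$ and every $f:[A]^n\to\{1,\dots,k\}$ there are $B\in[A]^{\aleph_0}\cap\Omega_X$ and $i\in\{1,\dots,k\}$ such that $f$ has value $i$ on all of $[B]^n$.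 *)

theory Defs
  imports "HOL-Analysis.Analysis" "HOL-Library.Ramsey"
begin

definition open_cover :: "'a topology \<Rightarrow> 'a set set \<Rightarrow> bool" where
  "open_cover X \<U> \<longleftrightarrow> (\<forall>U\<in>\<U>. openin X U) \<and> \<Union>\<U> = topspace X"

definition omega_covers :: "'a topology \<Rightarrow> 'a set set set" where
  "omega_covers X = {\<U>. open_cover X \<U> \<and> topspace X \<notin> \<U> \<and>
     (\<forall>F. finite F \<and> F \<subseteq> topspace X \<longrightarrow> (\<exists>U\<in>\<U>. F \<subseteq> U))}"

definition ctbl_infinite_subsets :: "'b set \<Rightarrow> 'b set set" where
  "ctbl_infinite_subsets S = {B. B \<subseteq> S \<and> countable B \<and> infinite B}"

text \<open>In the next three definitions \<open>a\<close> is a bijective enumeration of the ambient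
  countably infinite set.\<close>

definition precedes :: "(nat \<Rightarrow> 'b) \<Rightarrow> 'b set \<Rightarrow> 'b set \<Rightarrow> bool" where
  "precedes a s T \<longleftrightarrow> (\<forall>n m. a n \<in> s \<and> a m \<in> T \<longrightarrow> n < m)"

definition initial_segment :: "(nat \<Rightarrow> 'b) \<Rightarrow> 'b set \<Rightarrow> 'b set \<Rightarrow> bool" where
  "initial_segment a s C \<longleftrightarrow> finite s \<and> s \<subseteq> C \<and> precedes a s (C - s)"

definition thin :: "(nat \<Rightarrow> 'b) \<Rightarrow> 'b set set \<Rightarrow> bool" where
  "thin a \<T> \<longleftrightarrow> (\<forall>s\<in>\<T>. \<forall>t\<in>\<T>. s \<noteq> t \<longrightarrow> \<not> initial_segment a s t)"

text \<open>\<open>en A\<close> is the enumeration fixed for the countably infinite set \<open>A\<close>. As usual for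
  partition relations, pieces of the partition are pairwise disjoint but may be empty.\<close>

definition NW :: "('b set \<Rightarrow> nat \<Rightarrow> 'b) \<Rightarrow> 'b set set \<Rightarrow> 'b set set \<Rightarrow> bool" where
  "NW en \<A> \<B> \<longleftrightarrow>
    (\<forall>A\<in>\<A>. countable A \<and> infinite A \<longrightarrow>
      (\<forall>\<T>. \<T> \<subseteq> Fpow A \<and> thin (en A) \<T> \<longrightarrow>
        (\<forall>n>0. \<forall>P :: nat \<Rightarrow> 'b set set.
          disjoint_family_on P {1..n} \<and> (\<Union>i\<in>{1..n}. P i) = \<T> \<longrightarrow>
          (\<exists>B \<in> ctbl_infinite_subsets A \<inter> \<B>. \<exists>i\<in>{1..n}. Fpow B \<inter> \<T> \<subseteq> P i))))"

definition partition_arrow :: "'b set set \<Rightarrow> 'b set set \<Rightarrow> nat \<Rightarrow> nat \<Rightarrow> bool" where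
  "partition_arrow \<A> \<B> n k \<longleftrightarrow>
    (\<forall>A\<in>\<A>. countable A \<longrightarrow>
      (\<forall>f \<in> nsets A n \<rightarrow> {1..k}.
        \<exists>B \<in> ctbl_infinite_subsets A \<inter> \<B>. \<exists>i\<in>{1..k}. \<forall>s \<in> nsets B n. f s = i))"

end

theory Submission
  imports Defs
begin

text \<open>The \<open>n\<close>-element subsets of \<open>A\<close> form a thin family: a proper
  initial segment of a finite set has fewer elements (\<open>thin_nsets\<close>). A colouring
  \<open>f\<close> with \<open>k\<close> colours partitions this family into its colour classes, so
  \<open>NW\<close> gives a \<open>B\<close> whose \<open>n\<close>-subsets all lie in one class.
  \<open>NW\<close> speaks of countably infinite covers and the arrow relation of countable ones;
  \<open>infinite_omega_cover\<close> bridges the gap.\<close>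

text \<open>Each member omits a point of the space. Were there finitely many members, one of them
  would contain all the chosen omitted points, its own included.\<close>

lemma infinite_omega_cover:
  assumes "\<U> \<in> omega_covers X"
  shows "infinite \<U>"
proof
  assume fin: "finite \<U>"
  have "\<exists>x. x \<in> topspace X - U" if "U \<in> \<U>" for U
  proof -
    have "U \<subseteq> topspace X" "U \<noteq> topspace X"
      using assms that by (auto simp: omega_covers_def open_cover_def)
    then show ?thesis by blast
  qed
  then obtain p where p: "\<And>U. U \<in> \<U> \<Longrightarrow> p U \<in> topspace X - U"
    by metis
  then have "finite (p ` \<U>)" "p ` \<U> \<subseteq> topspace X"
    using fin by auto
  then obtain U where "U \<in> \<U>" "p ` \<U> \<subseteq> U"
    using assms unfolding omega_covers_def by blast
  with p show False by blast
qed

lemma thin_nsets: "thin a (nsets A n)"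
  unfolding thin_def initial_segment_def nsets_def
  by (auto dest: card_subset_eq)

text \<open>The topology enters only through \<open>inf\<close>, so the families are kept
  arbitrary.\<close>

lemma NW_imp_partition_arrow:
  assumes NW: "NW en \<A> \<B>"
    and inf: "\<And>A. A \<in> \<A> \<Longrightarrow> infinite A"
    and k: "k > 0"
  shows "partition_arrow \<A> \<B> n k"
  unfolding partition_arrow_def
proof (intro ballI impI)
  fix A f
  assume A: "A \<in> \<A>" "countable A" and f: "f \<in> nsets A n \<rightarrow> {1..k}"
  \<comment> \<open>The colour classes of \<open>f\<close>; some may be empty, which
    \<open>NW\<close> allows.\<close>
  define P where "P i = {s \<in> nsets A n. f s = i}" for i
  have "nsets A n \<subseteq> Fpow A"
    by (auto simp: nsets_def Fpow_def)
  moreover have "disjoint_family_on P {1..k}"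
    by (auto simp: disjoint_family_on_def P_def)
  moreover have "(\<Union>i\<in>{1..k}. P i) = nsets A n"
    using f by (auto simp: P_def)
  ultimately obtain B i where B: "B \<in> ctbl_infinite_subsets A \<inter> \<B>"
    and i: "i \<in> {1..k}" and sub: "Fpow B \<inter> nsets A n \<subseteq> P i"
    using NW A inf[OF A(1)] k thin_nsets unfolding NW_def by meson
  \<comment> \<open>Since \<open>B\<close> is a subset of \<open>A\<close>, its
    \<open>n\<close>-subsets belong to the thin family.\<close>
  have "nsets B n \<subseteq> Fpow B \<inter> nsets A n"
    using B by (auto simp: nsets_def Fpow_def ctbl_infinite_subsets_def)
  with sub have "\<forall>s \<in> nsets B n. f s = i"
    by (auto simp: P_def)
  with B i show "\<exists>B \<in> ctbl_infinite_subsets A \<inter> \<B>. \<exists>i\<in>{1..k}. \<forall>s \<in> nsets B n. f s = i"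
    by blast
qed

theorem theorem9:
  fixes X :: "'a topology"
    and en :: "'a set set \<Rightarrow> nat \<Rightarrow> 'a set"
  assumes "\<And>A. countable A \<Longrightarrow> infinite A \<Longrightarrow> bij_betw (en A) UNIV A"
    and "NW en (omega_covers X) (omega_covers X)"
  shows "\<forall>n>0. \<forall>k>0. partition_arrow (omega_covers X) (omega_covers X) n k"
  using NW_imp_partition_arrow[OF assms(2)] infinite_omega_cover by blast

end
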